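(* Let $d\ge 1$, let $v_1,\dots,v_d$ be $d$ distinct values, and let $O=\{\{v_1,\dots,v_d\}\}$. Under asynchrony and up to $f$ crashes in a system of $n$ processes, the condition $$n \ \ge\ \sum_{i=1}^{d}\left\lceil \frac{f+1}{i}\right\rceil$$ is necessary for implementing the set of output sets $O$; that is, if there is an asynchronous algorithm for $n$ processes tolerating up to $f$ crashes that solves the SOS problem $\Pi_O$ ($d$-disagreement), then this inequality holds.
   Context: Computing model. A system consists of a nonempty finite set $P=\{p_1,\dots,p_n\}$ of $n$ processes. Processes are deterministic and take steps according to their local state and the events they observe, following an algorithm $A$. In an execution, a process may crash (halt prematurely and take no further step) but does not otherwise deviate from its algorithm; at most $f$ processes may crash in an execution, with $0 \le f \le n$. A process that does not crash in an execution is correct in it. Each process has a private local clock, running at its own arbitrary pace, usable to set local timeouts. Processes interact through two operations: "communicate $I$" (disseminate information $I$ to all processes) and the callback "observe $I$" (be notified that $I$ was communicated), satisfying: (C-Validity) if a process observes $I$, then $I$ was previously communicated by some process; (C-Integrity) a process observes information $I$ communicated by a given process at most once; (C-Local-Termination) if a correct process communicates $I$, then some correct process (if there is any) eventually observes $I$; (C-Global-Termination) if a correct process observes $I$, then all correct processes eventually observe $I$. The system is asynchronous: there is no bound on communication delays, and any ordering or timing of observations consistent with these properties can occur. Tasks. $\mathbb{V}$ is a finite universe of values and $\bot \notin \mathbb{V}$ denotes no input or no output. For a system of size $n$, an input vector $V_{\rm in}$ and an output vector $V_{\rm out}$ are elements of $(\mathbb{V}\cup\{\bot\})^n$, whose $i$-th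 entries are the input and output values of process $p_i$. A process outputs at most one value in an execution. A task is a triple $T=(\mathcal{I},\mathcal{O},\Delta)$, where $\mathcal I,\mathcal O$ are sets of input and output vectors and $\Delta\subseteq\mathcal I\times\mathcal O$ is a nonempty relation whose pairs consist of vectors of the same size. $T_n=(\mathcal I_n,\mathcal O_n,\Delta_n)$ is the restriction of $T$ to vectors of size $n$. An algorithm $A$ implements $T$ if $T=(\mathcal I_A,\mathcal O_A,\Delta_A)$, where $\mathcal I_A,\mathcal O_A$ are the sets of input/output vectors admitted by $A$ and $\Delta_A$ is the set of pairs $(V_{\rm in},V_{\rm out})$ it produces across all its executions. $A$ supports a size $n$ if it admits executions with $n$ processes. SOS problems. The output set of an output vector is $\mathit{OS}(V_{\rm out})=\{v : v \text{ is an entry of } V_{\rm out},\ v\neq\bot\}$. For a task $T$, $\mathit{SOS}(T)=\{\mathit{OS}(V_{\rm out}) : (V_{\rm in},V_{\rm out})\in\Delta\}$. For nonempty $O\subseteq 2^{\mathbb V}$, the SOS problem $\Pi_O$ is the set of all (nonempty) tasks $T$ such that for every $n$ with $T_n\neq\varnothing$: (i) $\mathit{SOS}(T_n)=O$, and (ii) $\Delta_n=\mathcal I_n\times\mathcal O_n$. An algorithm solves $\Pi_O$ if it implements some task $T\in\Pi_O$. In particular it satisfies: (Safety) every execution of $A$ produces an output vector $V_{\rm out}$ with $\mathit{OS}(V_{\rm out})\in O$; (Completeness) for every size $n$ supported by $A$ and every $o\in O$, some execution of $A$ produces an output vector of size $n$ with output set $o$. For $O=\{\{v_1,\dots,v_d\}\}$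 with distinct $v_i$ ($d$-disagreement), this says that every execution must output exactly the $d$ values $v_1,\dots,v_d$. *)

theory Defs
  imports Complex_Main
begin

section \<open>Computing model\<close>

text \<open>
  The processes of a system of size \<open>n\<close> are the numbers \<open>0, \<dots>, n - 1\<close>. The origin of an observed
  piece of information is not passed on to the observer; an algorithm that needs it can put it into
  the information itself.

  A step is the reaction of one process to one event, either a tick of its private clock or an
  observation: it yields the new local state, the information communicated, and possibly an output
  value. The initial state may depend on the system size, on the identity of the process and on its
  input. Clock values and timeouts are part of the local state, counted in ticks.
\<close>

datatype 'm event = Tick | Observe 'm

record ('s, 'm, 'v) algorithm =
  inputs :: "'v option list set"
  init :: "nat \<Rightarrow> nat \<Rightarrow> 'v option \<Rightarrow> 's"
  step :: "'s \<Rightarrow> 'm event \<Rightarrow> 's \<times> 'm list \<times> 'v option"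

text \<open>
  A schedule says what happens at each instant: nothing, a clock tick at \<open>p\<close>, or the observation
  by \<open>p\<close> of the information \<open>I\<close> communicated by \<open>q\<close> (\<open>Obs p q I\<close>). As processes are deterministic,
  an input vector and a schedule determine everything else.
\<close>

datatype 'm occurrence = Idle | Clock nat | Obs nat nat 'm

type_synonym 'm schedule = "nat \<Rightarrow> 'm occurrence"

fun event_at :: "'m occurrence \<Rightarrow> nat \<Rightarrow> 'm event option" where
  "event_at Idle p = None"
| "event_at (Clock r) p = (if r = p then Some Tick else None)"
| "event_at (Obs r q I) p = (if r = p then Some (Observe I) else None)"

primrec local_state ::
  "('s, 'm, 'v) algorithm \<Rightarrow> 'v option list \<Rightarrow> 'm schedule \<Rightarrow> nat \<Rightarrow> nat \<Rightarrow> 's" where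
  "local_state A V \<sigma> 0 p = init A (length V) p (V ! p)"
| "local_state A V \<sigma> (Suc k) p =
    (case event_at (\<sigma> k) p of
       None \<Rightarrow> local_state A V \<sigma> k p
     | Some e \<Rightarrow> fst (step A (local_state A V \<sigma> k p) e))"

definition communicates ::
  "('s, 'm, 'v) algorithm \<Rightarrow> 'v option list \<Rightarrow> 'm schedule \<Rightarrow> nat \<Rightarrow> nat \<Rightarrow> 'm \<Rightarrow> bool" where
  "communicates A V \<sigma> k p I \<longleftrightarrow>
    (\<exists>e. event_at (\<sigma> k) p = Some e \<and> I \<in> set (fst (snd (step A (local_state A V \<sigma> k p) e))))"

definition outputs ::
  "('s, 'm, 'v) algorithm \<Rightarrow> 'v option list \<Rightarrow> 'm schedule \<Rightarrow> nat \<Rightarrow> nat \<Rightarrow> 'v \<Rightarrow> bool" where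
  "outputs A V \<sigma> k p v \<longleftrightarrow>
    (\<exists>e. event_at (\<sigma> k) p = Some e \<and> snd (snd (step A (local_state A V \<sigma> k p) e)) = Some v)"

text \<open>
  A crashed process is one that stops taking steps. A correct process that has nothing left to do
  still receives clock ticks, see \<open>clocks_run\<close> below.
\<close>

definition crashed :: "nat \<Rightarrow> 'm schedule \<Rightarrow> nat set" where
  "crashed n \<sigma> = {p. p < n \<and> finite {k. event_at (\<sigma> k) p \<noteq> None}}"

definition correct :: "nat \<Rightarrow> 'm schedule \<Rightarrow> nat set" where
  "correct n \<sigma> = {..<n} - crashed n \<sigma>"

definition clocks_run :: "nat \<Rightarrow> 'm schedule \<Rightarrow> bool" where
  "clocks_run n \<sigma> \<longleftrightarrow> (\<forall>p \<in> correct n \<sigma>. infinite {k. \<sigma> k = Clock p})"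

definition C_Validity ::
  "('s, 'm, 'v) algorithm \<Rightarrow> 'v option list \<Rightarrow> 'm schedule \<Rightarrow> bool" where
  "C_Validity A V \<sigma> \<longleftrightarrow>
    (\<forall>k p q I. \<sigma> k = Obs p q I \<longrightarrow> (\<exists>j<k. communicates A V \<sigma> j q I))"

definition C_Integrity :: "'m schedule \<Rightarrow> bool" where
  "C_Integrity \<sigma> \<longleftrightarrow> (\<forall>k l p q I. \<sigma> k = Obs p q I \<and> \<sigma> l = Obs p q I \<longrightarrow> k = l)"

text \<open>
  ``Eventually'' needs no comparison of instants in the two termination properties: by validity, an
  observation always comes after the first communication, and by integrity, communicating the same
  information again cannot trigger a second observation by the same process.
\<close>

definition C_Local_Termination ::
  "('s, 'm, 'v) algorithm \<Rightarrow> 'v option list \<Rightarrow> 'm schedule \<Rightarrow> bool" where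
  "C_Local_Termination A V \<sigma> \<longleftrightarrow>
    (\<forall>q \<in> correct (length V) \<sigma>. \<forall>k I. communicates A V \<sigma> k q I \<longrightarrow>
       (\<exists>p \<in> correct (length V) \<sigma>. \<exists>l. \<sigma> l = Obs p q I))"

definition C_Global_Termination :: "nat \<Rightarrow> 'm schedule \<Rightarrow> bool" where
  "C_Global_Termination n \<sigma> \<longleftrightarrow>
    (\<forall>r \<in> correct n \<sigma>. \<forall>k q I. \<sigma> k = Obs r q I \<longrightarrow>
       (\<forall>p \<in> correct n \<sigma>. \<exists>l. \<sigma> l = Obs p q I))"

text \<open>
  \<open>F m\<close> is the maximal number of crashes in a system of size \<open>m\<close>. Asynchrony: every schedule with
  the stated properties is an execution.
\<close>

definition execution ::
  "('s, 'm, 'v) algorithm \<Rightarrow> (nat \<Rightarrow> nat) \<Rightarrow> 'v option list \<Rightarrow> 'm schedule \<Rightarrow> bool" where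
  "execution A F V \<sigma> \<longleftrightarrow>
     V \<in> inputs A \<and>
     (\<forall>k p. event_at (\<sigma> k) p \<noteq> None \<longrightarrow> p < length V) \<and>
     card (crashed (length V) \<sigma>) \<le> F (length V) \<and>
     clocks_run (length V) \<sigma> \<and>
     C_Validity A V \<sigma> \<and>
     C_Integrity \<sigma> \<and>
     C_Local_Termination A V \<sigma> \<and>
     C_Global_Termination (length V) \<sigma>"

definition supports :: "('s, 'm, 'v) algorithm \<Rightarrow> (nat \<Rightarrow> nat) \<Rightarrow> nat \<Rightarrow> bool" where
  "supports A F n \<longleftrightarrow> (\<exists>V \<sigma>. execution A F V \<sigma> \<and> length V = n)"

definition single_output :: "('s, 'm, 'v) algorithm \<Rightarrow> (nat \<Rightarrow> nat) \<Rightarrow> bool" where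
  "single_output A F \<longleftrightarrow>
    (\<forall>V \<sigma> p k l v w. execution A F V \<sigma> \<and> outputs A V \<sigma> k p v \<and> outputs A V \<sigma> l p w \<longrightarrow> v = w)"

text \<open>
  The output of a process counts even if the process crashes later. Under \<open>single_output\<close>, every
  execution produces exactly one output vector.
\<close>

definition produces ::
  "('s, 'm, 'v) algorithm \<Rightarrow> 'v option list \<Rightarrow> 'm schedule \<Rightarrow> 'v option list \<Rightarrow> bool" where
  "produces A V \<sigma> W \<longleftrightarrow>
     length W = length V \<and>
     (\<forall>p < length V. \<forall>v. W ! p = Some v \<longleftrightarrow> (\<exists>k. outputs A V \<sigma> k p v))"


section \<open>Tasks and SOS problems\<close>

type_synonym 'v task =
  "'v option list set \<times> 'v option list set \<times> ('v option list \<times> 'v option list) set"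

definition is_task :: "'v task \<Rightarrow> bool" where
  "is_task T \<longleftrightarrow>
    (case T of (\<I>, \<O>, \<Delta>) \<Rightarrow>
       [] \<notin> \<I> \<and> [] \<notin> \<O> \<and> \<Delta> \<subseteq> \<I> \<times> \<O> \<and> \<Delta> \<noteq> {} \<and> (\<forall>(V, W) \<in> \<Delta>. length V = length W))"

definition restrict_task :: "'v task \<Rightarrow> nat \<Rightarrow> 'v task" where
  "restrict_task T n =
    (case T of (\<I>, \<O>, \<Delta>) \<Rightarrow>
       ({V \<in> \<I>. length V = n}, {W \<in> \<O>. length W = n},
        {(V, W) \<in> \<Delta>. length V = n \<and> length W = n}))"

definition output_set :: "'v option list \<Rightarrow> 'v set" where
  "output_set W = {v. Some v \<in> set W}"

definition SOS :: "'v task \<Rightarrow> 'v set set" where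
  "SOS T = (case T of (\<I>, \<O>, \<Delta>) \<Rightarrow> {output_set W | V W. (V, W) \<in> \<Delta>})"

definition SOS_problem :: "'v set set \<Rightarrow> 'v task set" where
  "SOS_problem Os =
    {T. is_task T \<and>
        (\<forall>n. case restrict_task T n of (\<I>, \<O>, \<Delta>) \<Rightarrow>
           \<Delta> \<noteq> {} \<longrightarrow> SOS (\<I>, \<O>, \<Delta>) = Os \<and> \<Delta> = \<I> \<times> \<O>)}"

definition task_of :: "('s, 'm, 'v) algorithm \<Rightarrow> (nat \<Rightarrow> nat) \<Rightarrow> 'v task" where
  "task_of A F =
    ({V. \<exists>\<sigma>. execution A F V \<sigma>},
     {W. \<exists>V \<sigma>. execution A F V \<sigma> \<and> produces A V \<sigma> W},
     {(V, W). \<exists>\<sigma>. execution A F V \<sigma> \<and> produces A V \<sigma> W})"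

definition implements :: "('s, 'm, 'v) algorithm \<Rightarrow> (nat \<Rightarrow> nat) \<Rightarrow> 'v task \<Rightarrow> bool" where
  "implements A F T \<longleftrightarrow> single_output A F \<and> T = task_of A F"

definition solves :: "('s, 'm, 'v) algorithm \<Rightarrow> (nat \<Rightarrow> nat) \<Rightarrow> 'v task set \<Rightarrow> bool" where
  "solves A F \<Pi> \<longleftrightarrow> (\<exists>T \<in> \<Pi>. implements A F T)"

end

theory Submission
  imports Defs "HOL-Library.Countable" "HOL-Library.Infinite_Set"
begin

text \<open>
  The adversary holds back every process whose next step would output a value that has not been
  output yet. While at most \<open>f\<close> processes are held back, they may be taken for crashed, so the others
  must go on to output all missing values. Hence \<open>f + 1\<close> processes get held back eventually. If \<open>i\<close>
  values are missing, some value is about to be output by at least \<open>\<lceil>(f + 1) / i\<rceil>\<close> of these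
  processes; the adversary lets all of them take their step and continues with the other \<open>i - 1\<close>
  values. No process outputs two values, so the processes counted for different values are distinct.
\<close>

section \<open>Finite prefixes of schedules\<close>

definition agree :: "nat \<Rightarrow> 'm schedule \<Rightarrow> 'm schedule \<Rightarrow> bool" where
  "agree K \<sigma> \<tau> \<longleftrightarrow> (\<forall>k<K. \<sigma> k = \<tau> k)"

lemma agree_refl [simp]: "agree K \<sigma> \<sigma>"
  by (simp add: agree_def)

lemma agree_trans: "agree K \<sigma> \<tau> \<Longrightarrow> agree L \<tau> \<rho> \<Longrightarrow> K \<le> L \<Longrightarrow> agree K \<sigma> \<rho>"
  by (simp add: agree_def)

lemma local_state_agree: "agree k \<sigma> \<tau> \<Longrightarrow> local_state A V \<sigma> k p = local_state A V \<tau> k p"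
  by (induction k) (auto simp: agree_def split: option.splits)

lemma communicates_agree:
  assumes "agree K \<sigma> \<tau>" "k < K"
  shows "communicates A V \<sigma> k p I \<longleftrightarrow> communicates A V \<tau> k p I"
proof -
  have "\<sigma> k = \<tau> k" "agree k \<sigma> \<tau>" using assms by (auto simp: agree_def)
  then show ?thesis by (simp add: communicates_def local_state_agree)
qed

lemma outputs_agree:
  assumes "agree K \<sigma> \<tau>" "k < K"
  shows "outputs A V \<sigma> k p x \<longleftrightarrow> outputs A V \<tau> k p x"
proof -
  have "\<sigma> k = \<tau> k" "agree k \<sigma> \<tau>" using assms by (auto simp: agree_def)
  then show ?thesis by (simp add: outputs_def local_state_agree)
qed

text \<open>The safety half of \<open>execution\<close> for a single candidate \<open>c\<close>,
  looking only at instants before \<open>k\<close>, so that it can be checked while the schedule is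
  still being built.\<close>

definition legal ::
  "('s, 'm, 'v) algorithm \<Rightarrow> 'v option list \<Rightarrow> 'm schedule \<Rightarrow> nat \<Rightarrow> 'm occurrence \<Rightarrow> bool" where
  "legal A V \<sigma> k c \<longleftrightarrow>
    (\<forall>p. event_at c p \<noteq> None \<longrightarrow> p < length V) \<and>
    (\<forall>p q I. c = Obs p q I \<longrightarrow>
       (\<exists>j<k. communicates A V \<sigma> j q I) \<and> (\<forall>j<k. \<sigma> j \<noteq> Obs p q I))"

lemma legal_agree: "agree k \<sigma> \<tau> \<Longrightarrow> legal A V \<sigma> k c \<longleftrightarrow> legal A V \<tau> k c"
  using communicates_agree[of k \<sigma> \<tau> _ A V] unfolding legal_def agree_def by metis

definition safe ::
  "('s, 'm, 'v) algorithm \<Rightarrow> 'v option list \<Rightarrow> 'm schedule \<Rightarrow> nat \<Rightarrow> bool" where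
  "safe A V \<sigma> K \<longleftrightarrow> (\<forall>k<K. legal A V \<sigma> k (\<sigma> k))"

lemma safe_agree:
  assumes "agree K \<sigma> \<tau>" "safe A V \<sigma> K"
  shows "safe A V \<tau> K"
proof -
  have "legal A V \<tau> k (\<tau> k)" if "k < K" for k
  proof -
    have "\<sigma> k = \<tau> k" "agree k \<sigma> \<tau>" using assms(1) that by (auto simp: agree_def)
    then show ?thesis using assms(2) that by (metis legal_agree safe_def)
  qed
  then show ?thesis by (simp add: safe_def)
qed

lemma safe_fun_upd:
  assumes "safe A V \<sigma> K" "legal A V \<sigma> K c"
  shows "safe A V (\<sigma>(K := c)) (Suc K)"
proof -
  have a: "agree K \<sigma> (\<sigma>(K := c))" by (simp add: agree_def)
  show ?thesis
    using safe_agree[OF a assms(1)] assms(2) legal_agree[OF a]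
    by (auto simp: safe_def less_Suc_eq)
qed

section \<open>Delaying the steps of a silent process\<close>

definition quiet :: "'m schedule \<Rightarrow> nat \<Rightarrow> nat \<Rightarrow> nat \<Rightarrow> bool" where
  "quiet \<sigma> K L p \<longleftrightarrow> (\<forall>k. K \<le> k \<and> k < L \<longrightarrow> event_at (\<sigma> k) p = None)"

lemma local_state_quiet:
  assumes "K \<le> L" "quiet \<sigma> K L p"
  shows "local_state A V \<sigma> L p = local_state A V \<sigma> K p"
  using assms by (induction L rule: dec_induct) (auto simp: quiet_def)

text \<open>Asynchrony in miniature: earlier communications stay available, and only a step of
  \<open>p\<close> itself could use up the observation that \<open>c\<close> offers to
  \<open>p\<close>.\<close>

lemma legal_quiet:
  assumes "legal A V \<sigma> K c" "event_at c p = Some e" "quiet \<sigma> K L p" "K \<le> L"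
  shows "legal A V \<sigma> L c"
proof -
  have "\<sigma> j \<noteq> Obs p' q I" if "c = Obs p' q I" "j < L" for p' q I j
  proof (cases "j < K")
    case True
    then show ?thesis using assms(1) that by (auto simp: legal_def)
  next
    case False
    have "p' = p" using assms(2) that by (auto split: if_splits)
    moreover have "event_at (\<sigma> j) p = None" using assms(3) False that by (auto simp: quiet_def)
    ultimately show ?thesis by auto
  qed
  then show ?thesis using assms(1,4) by (fastforce simp: legal_def)
qed

section \<open>Fair extensions\<close>

text \<open>A list gives each information a position, so that \<open>fair_next\<close> can refer to
  it by a number even if the type of informations is uncountable.\<close>

definition messages ::
  "('s, 'm, 'v) algorithm \<Rightarrow> 'v option list \<Rightarrow> 'm schedule \<Rightarrow> nat \<Rightarrow> nat \<Rightarrow> 'm list" where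
  "messages A V \<sigma> j q =
    (case event_at (\<sigma> j) q of
       None \<Rightarrow> []
     | Some e \<Rightarrow> fst (snd (step A (local_state A V \<sigma> j q) e)))"

lemma communicates_messages: "communicates A V \<sigma> j q I \<longleftrightarrow> I \<in> set (messages A V \<sigma> j q)"
  by (cases "event_at (\<sigma> j) q") (auto simp: communicates_def messages_def)

lemma messages_agree:
  assumes "agree K \<sigma> \<tau>" "k < K"
  shows "messages A V \<sigma> k p = messages A V \<tau> k p"
proof -
  have "\<sigma> k = \<tau> k" "agree k \<sigma> \<tau>" using assms by (auto simp: agree_def)
  then show ?thesis by (simp add: messages_def local_state_agree split: option.split)
qed

text \<open>
  The first component of \<open>prod_decode k\<close> takes every value infinitely often. It encodes what to do at
  time \<open>k\<close>: a clock tick at \<open>r\<close>, or the observation by \<open>r\<close> of the \<open>i\<close>-th information that \<open>q\<close>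
  communicated at time \<open>j\<close>. The processes in \<open>H\<close> are held back.
\<close>

definition fair_next ::
  "('s, 'm, 'v) algorithm \<Rightarrow> 'v option list \<Rightarrow> nat set \<Rightarrow> 'm schedule \<Rightarrow> nat \<Rightarrow> 'm occurrence" where
  "fair_next A V H \<sigma> k =
    (case from_nat (fst (prod_decode k)) of
       Inl r \<Rightarrow> if r < length V \<and> r \<notin> H then Clock r else Idle
     | Inr (r, q, j, i) \<Rightarrow>
         if r < length V \<and> r \<notin> H \<and> j < k \<and> i < length (messages A V \<sigma> j q) \<and>
            (\<forall>l<k. \<sigma> l \<noteq> Obs r q (messages A V \<sigma> j q ! i))
         then Obs r q (messages A V \<sigma> j q ! i) else Idle)"

lemma fair_next_agree:
  assumes "agree k \<sigma> \<tau>"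
  shows "fair_next A V H \<sigma> k = fair_next A V H \<tau> k"
proof -
  have "\<sigma> l = \<tau> l" "messages A V \<sigma> l q = messages A V \<tau> l q" if "l < k" for l q
    using assms that messages_agree[OF assms] by (auto simp: agree_def)
  then show ?thesis
    by (auto simp: fair_next_def split: sum.splits)
qed

lemma fair_next_legal: "legal A V \<sigma> k (fair_next A V H \<sigma> k)"
  by (auto simp: fair_next_def legal_def communicates_messages split: sum.splits if_splits)

lemma fair_next_quiet: "p \<in> H \<Longrightarrow> event_at (fair_next A V H \<sigma> k) p = None"
  by (auto simp: fair_next_def split: sum.splits)

primrec fair_prefix ::
  "('s, 'm, 'v) algorithm \<Rightarrow> 'v option list \<Rightarrow> nat set \<Rightarrow> nat \<Rightarrow> 'm schedule \<Rightarrow> nat \<Rightarrow> 'm schedule" where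
  "fair_prefix A V H K \<sigma> 0 = \<sigma>"
| "fair_prefix A V H K \<sigma> (Suc k) =
    (if k < K then fair_prefix A V H K \<sigma> k
     else (fair_prefix A V H K \<sigma> k)(k := fair_next A V H (fair_prefix A V H K \<sigma> k) k))"

lemma fair_prefix_stable: "j < k \<Longrightarrow> fair_prefix A V H K \<sigma> k j = fair_prefix A V H K \<sigma> (Suc j) j"
proof (induction k)
  case (Suc k)
  then show ?case by (cases "j = k") auto
qed simp

text \<open>The limit takes entry \<open>k\<close> from approximation \<open>Suc k\<close>, where it
  is final. As \<open>fair_next\<close> at \<open>k\<close> reads earlier entries only, it gives the
  same result for the approximation and for the limit.\<close>

lemma fair_schedule_exists:
  obtains \<tau> where "agree K \<sigma> \<tau>" "\<And>k. K \<le> k \<Longrightarrow> \<tau> k = fair_next A V H \<tau> k"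
proof
  let ?b = "fair_prefix A V H K \<sigma>"
  define \<tau> where "\<tau> k = ?b (Suc k) k" for k
  have ag: "agree k (?b k) \<tau>" for k
    unfolding agree_def \<tau>_def by (meson fair_prefix_stable)
  have "?b k = \<sigma>" if "k \<le> K" for k
    using that by (induction k) auto
  then show "agree K \<sigma> \<tau>" using ag[of K] by simp
  show "\<tau> k = fair_next A V H \<tau> k" if "K \<le> k" for k
    using that fair_next_agree[OF ag[of k]] by (simp add: \<tau>_def)
qed

text \<open>The processes in \<open>H\<close> fall silent at \<open>K\<close> and pass for crashed,
  within the budget \<open>F\<close>. All other processes of the system tick forever and receive
  everything that is communicated, so none of them is crashed and both termination properties
  hold.\<close>

lemma fair_extension:
  fixes F :: "nat \<Rightarrow> nat"
  assumes "V \<in> inputs A" "safe A V \<sigma> K" "finite H" "card H \<le> F (length V)"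
  obtains \<tau> where "execution A F V \<tau>" "agree K \<sigma> \<tau>" "\<And>p L. p \<in> H \<Longrightarrow> quiet \<tau> K L p"
proof -
  obtain \<tau> where ag: "agree K \<sigma> \<tau>" and nx: "\<And>k. K \<le> k \<Longrightarrow> \<tau> k = fair_next A V H \<tau> k"
    using fair_schedule_exists by blast
  have legal: "legal A V \<tau> k (\<tau> k)" for k
  proof (cases "k < K")
    case True
    then show ?thesis using safe_agree[OF ag assms(2)] by (simp add: safe_def)
  next
    case False
    then show ?thesis by (metis fair_next_legal not_less nx)
  qed
  have silent: "event_at (\<tau> k) p = None" if "p \<in> H" "K \<le> k" for p k
    by (subst nx[OF that(2)]) (rule fair_next_quiet[OF that(1)])
  have clock: "infinite {k. \<tau> k = Clock r}" if "r < length V" "r \<notin> H" for r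
  proof -
    \<comment> \<open>All instants \<open>?c m\<close> encode a tick of \<open>r\<close>. The
      argument \<open>m + K\<close> puts the instant past \<open>m\<close>, for unboundedness, and
      past \<open>K\<close>, where \<open>fair_next\<close> is in force.\<close>
    let ?c = "\<lambda>m. prod_encode (to_nat (Inl r :: nat + nat \<times> nat \<times> nat \<times> nat), m)"
    have "\<exists>k\<ge>m. k \<in> {k. \<tau> k = Clock r}" for m
    proof (intro exI conjI)
      have le: "m + K \<le> ?c (m + K)" by (rule le_prod_encode_2)
      then show "m \<le> ?c (m + K)" by linarith
      show "?c (m + K) \<in> {k. \<tau> k = Clock r}"
        using le nx[of "?c (m + K)"] that by (simp add: fair_next_def)
    qed
    then show ?thesis by (simp add: infinite_nat_iff_unbounded_le)
  qed
  have crashed: "crashed (length V) \<tau> \<subseteq> H"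
  proof
    fix p assume p: "p \<in> crashed (length V) \<tau>"
    have "{k. \<tau> k = Clock p} \<subseteq> {k. event_at (\<tau> k) p \<noteq> None}" by auto
    then show "p \<in> H" using p clock[of p] by (auto simp: crashed_def dest: finite_subset)
  qed
  have correct: "r < length V \<and> r \<notin> H" if "r \<in> correct (length V) \<tau>" for r
  proof (rule ccontr)
    assume "\<not> ?thesis"
    then have r: "r < length V" "r \<in> H" using that by (auto simp: correct_def)
    have "{k. event_at (\<tau> k) r \<noteq> None} \<subseteq> {..<K}"
      using silent[OF r(2)] by (auto simp: not_le[symmetric])
    then have "r \<in> crashed (length V) \<tau>" using r by (auto simp: crashed_def dest: finite_subset)
    then show False using that by (simp add: correct_def)
  qed
  have deliver: "\<exists>l. \<tau> l = Obs r q I"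
    if sent: "communicates A V \<tau> j q I" and "r \<in> correct (length V) \<tau>" for r q I j
  proof -
    obtain i where i: "i < length (messages A V \<tau> j q)" "messages A V \<tau> j q ! i = I"
      using sent by (auto simp: communicates_messages in_set_conv_nth)
    \<comment> \<open>This slot comes after \<open>K\<close>, where \<open>fair_next\<close> is in
      force, and after \<open>j\<close>, as its guard demands. If \<open>r\<close> has observed
      \<open>I\<close> from \<open>q\<close> before the slot, that observation serves
      instead.\<close>
    let ?k = "prod_encode (to_nat (Inr (r, q, j, i) :: nat + nat \<times> nat \<times> nat \<times> nat), K + Suc j)"
    have le: "K + Suc j \<le> ?k" by (rule le_prod_encode_2)
    then have eq: "\<tau> ?k = fair_next A V H \<tau> ?k" by (intro nx) linarith
    show ?thesis
    proof (cases "\<forall>l<?k. \<tau> l \<noteq> Obs r q I")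
      case True
      moreover have "j < ?k" using le by linarith
      ultimately have "fair_next A V H \<tau> ?k = Obs r q I"
        using i correct[OF that(2)] by (simp add: fair_next_def)
      then show ?thesis using eq by metis
    qed blast
  qed
  have "execution A F V \<tau>"
    unfolding execution_def
  proof (intro conjI)
    show "\<forall>k p. event_at (\<tau> k) p \<noteq> None \<longrightarrow> p < length V"
      using legal by (meson legal_def)
    show "card (crashed (length V) \<tau>) \<le> F (length V)"
      using card_mono[OF assms(3) crashed] assms(4) by linarith
    show "clocks_run (length V) \<tau>"
      using clock correct by (simp add: clocks_run_def)
    show val: "C_Validity A V \<tau>"
      using legal unfolding C_Validity_def legal_def by metis
    show "C_Integrity \<tau>"
      unfolding C_Integrity_def
    proof (intro allI impI)
      fix k l p q I assume "\<tau> k = Obs p q I \<and> \<tau> l = Obs p q I"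
      then show "k = l" using legal[of k] legal[of l] unfolding legal_def by (metis nat_neq_iff)
    qed
    show "C_Local_Termination A V \<tau>"
      using deliver unfolding C_Local_Termination_def by blast
    show "C_Global_Termination (length V) \<tau>"
      using deliver val unfolding C_Global_Termination_def C_Validity_def by blast
  qed (use assms(1) in simp)
  moreover have "quiet \<tau> K L p" if "p \<in> H" for p L
    using silent[OF that] by (simp add: quiet_def)
  ultimately show ?thesis using that ag by blast
qed

section \<open>Holding back and releasing processes\<close>

definition poised ::
  "('s, 'm, 'v) algorithm \<Rightarrow> 'v option list \<Rightarrow> 'm schedule \<Rightarrow> nat \<Rightarrow> nat \<Rightarrow> 'v \<Rightarrow> bool" where
  "poised A V \<sigma> K p x \<longleftrightarrow>
    (\<exists>c e. legal A V \<sigma> K c \<and> event_at c p = Some e \<and>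
       snd (snd (step A (local_state A V \<sigma> K p) e)) = Some x)"

text \<open>Silence preserves both the local state of \<open>p\<close> and the legality of its
  pending event, so the adversary can postpone the output at will.\<close>

lemma poised_quiet:
  assumes "poised A V \<sigma> K p x" "agree K \<sigma> \<tau>" "quiet \<tau> K L p" "K \<le> L"
  shows "poised A V \<tau> L p x"
proof -
  obtain c e where c: "legal A V \<sigma> K c" "event_at c p = Some e"
    "snd (snd (step A (local_state A V \<sigma> K p) e)) = Some x"
    using assms(1) by (auto simp: poised_def)
  have "legal A V \<tau> L c"
    using c legal_agree[OF assms(2)] legal_quiet[OF _ c(2) assms(3,4)] by blast
  moreover have "local_state A V \<tau> L p = local_state A V \<sigma> K p"
    using local_state_quiet[OF assms(4,3)] local_state_agree[OF assms(2)] by metis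
  ultimately show ?thesis using c by (auto simp: poised_def)
qed

text \<open>Invariant of the adversary: \<open>R\<close> holds the values still missing,
  \<open>H\<close> the processes held back, \<open>g p\<close> the value that \<open>p\<close> is
  about to output. It does not demand \<open>g p\<close> to lie in \<open>R\<close>, because during
  a release the value concerned has already left \<open>R\<close>.\<close>

definition stage ::
  "('s, 'm, 'v) algorithm \<Rightarrow> 'v option list \<Rightarrow> 'v set \<Rightarrow> 'm schedule \<Rightarrow> nat \<Rightarrow>
    nat set \<Rightarrow> (nat \<Rightarrow> 'v) \<Rightarrow> bool" where
  "stage A V R \<sigma> K H g \<longleftrightarrow>
    safe A V \<sigma> K \<and> (\<forall>k<K. \<forall>p. \<forall>x\<in>R. \<not> outputs A V \<sigma> k p x) \<and>
    H \<subseteq> {..<length V} \<and> (\<forall>p\<in>H. poised A V \<sigma> K p (g p))"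

text \<open>With \<open>H\<close> taken for crashed, the run still has to output \<open>y\<close>.
  So a first output of a value in \<open>R\<close> occurs; its process lies outside \<open>H\<close>
  and joins it, frozen just before that step.\<close>

lemma stage_grow:
  fixes F :: "nat \<Rightarrow> nat"
  assumes st: "stage A V R \<sigma> K H g" and V: "V \<in> inputs A" and y: "y \<in> R"
    and out: "\<And>\<tau>. execution A F V \<tau> \<Longrightarrow> \<exists>k p. outputs A V \<tau> k p y"
    and card: "card H \<le> F (length V)"
  obtains \<tau> L p x where "agree K \<sigma> \<tau>" "K \<le> L" "p \<notin> H" "x \<in> R"
    "stage A V R \<tau> L (insert p H) (g(p := x))"
proof -
  have fin: "finite H" using st finite_subset by (auto simp: stage_def)
  obtain \<tau> where ex: "execution A F V \<tau>" and ag: "agree K \<sigma> \<tau>"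
    and q: "\<And>p L. p \<in> H \<Longrightarrow> quiet \<tau> K L p"
    using fair_extension[where F = F, OF V _ fin card] st unfolding stage_def by metis
  let ?Q = "\<lambda>k. \<exists>p. \<exists>x\<in>R. outputs A V \<tau> k p x"
  \<comment> \<open>Instant \<open>L\<close> itself is cut off: the prefix ends before the output,
    and the entry at \<open>L\<close> only witnesses that its process is poised.\<close>
  define L where "L = (LEAST k. ?Q k)"
  have exQ: "\<exists>k. ?Q k" using out[OF ex] y by blast
  have QL: "?Q L" unfolding L_def using exQ by (rule LeastI_ex)
  have min: "\<not> ?Q k" if "k < L" for k using that unfolding L_def by (rule not_less_Least)
  obtain p x where px: "x \<in> R" "outputs A V \<tau> L p x" using QL by blast
  have KL: "K \<le> L"
  proof (rule ccontr)
    assume "\<not> K \<le> L"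
    then show False using px st outputs_agree[OF ag, of L] unfolding stage_def by (metis not_le)
  qed
  obtain e where e: "event_at (\<tau> L) p = Some e"
    "snd (snd (step A (local_state A V \<tau> L p) e)) = Some x"
    using px(2) by (auto simp: outputs_def)
  have pH: "p \<notin> H"
    using q[of p "Suc L"] KL e(1) by (auto simp: quiet_def)
  have legal: "legal A V \<tau> k (\<tau> k)" for k
    using ex unfolding execution_def legal_def C_Validity_def C_Integrity_def
    by (metis nat_neq_iff)
  have "poised A V \<tau> L p x"
    using legal[of L] e by (auto simp: poised_def)
  moreover have "poised A V \<tau> L r (g r)" if "r \<in> H" for r
    using that st ag KL q by (auto simp: stage_def intro: poised_quiet)
  moreover have "p < length V" using legal[of L] e(1) by (simp add: legal_def)
  ultimately have "stage A V R \<tau> L (insert p H) (g(p := x))"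
    using legal st min pH by (auto simp: stage_def safe_def)
  then show ?thesis using that ag KL pH px(1) by blast
qed

text \<open>Growing is possible while at most \<open>F (length V)\<close> processes are held back,
  so the last application reaches one more than can pass for crashed.\<close>

lemma stage_fill:
  fixes F :: "nat \<Rightarrow> nat"
  assumes "stage A V R \<sigma> K H g" and V: "V \<in> inputs A" and y: "y \<in> R"
    and out: "\<And>\<tau>. execution A F V \<tau> \<Longrightarrow> \<exists>k p. outputs A V \<tau> k p y"
    and "card H \<le> F (length V) + 1" and "g ` H \<subseteq> R"
  shows "\<exists>\<tau> L H' g'. agree K \<sigma> \<tau> \<and> K \<le> L \<and> stage A V R \<tau> L H' g' \<and>
    card H' = F (length V) + 1 \<and> g' ` H' \<subseteq> R"
  using assms(1,5,6)
proof (induction "F (length V) + 1 - card H" arbitrary: \<sigma> K H g)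
  case 0
  then show ?case by (metis agree_refl diff_is_0_eq le_antisym order_refl)
next
  case (Suc m)
  have card: "card H \<le> F (length V)" using Suc.hyps(2) by linarith
  obtain \<tau> L p x where t: "agree K \<sigma> \<tau>" "K \<le> L" "p \<notin> H" "x \<in> R"
    "stage A V R \<tau> L (insert p H) (g(p := x))"
    using stage_grow[where F = F, OF Suc.prems(1) V y out card] by metis
  have "finite H" using Suc.prems(1) finite_subset by (auto simp: stage_def)
  then have card': "card (insert p H) = Suc (card H)" using t(3) by simp
  have "(g(p := x)) ` insert p H \<subseteq> R" using Suc.prems(3) t(4) by auto
  then obtain \<tau>' L' H' g' where "agree L \<tau> \<tau>'" "L \<le> L'" "stage A V R \<tau>' L' H' g'"
    "card H' = F (length V) + 1" "g' ` H' \<subseteq> R"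
    using Suc.hyps(1)[OF _ t(5)] Suc.hyps(2) card card' by fastforce
  then show ?case using t(1,2) agree_trans by (meson order_trans)
qed

text \<open>The pending event of \<open>p\<close> is played at instant \<open>K\<close>. It touches
  no other process, so those in \<open>H\<close> stay poised; its output is outside
  \<open>R\<close>, so the ban on outputs in \<open>R\<close> survives.\<close>

lemma stage_release_one:
  assumes st: "stage A V R \<sigma> K (insert p H) g" and "p \<notin> H" "g p \<notin> R"
  obtains \<tau> where "agree K \<sigma> \<tau>" "stage A V R \<tau> (Suc K) H g" "outputs A V \<tau> K p (g p)"
proof -
  obtain c e where c: "legal A V \<sigma> K c" "event_at c p = Some e"
    "snd (snd (step A (local_state A V \<sigma> K p) e)) = Some (g p)"
    using st by (auto simp: stage_def poised_def)
  define \<tau> where "\<tau> = \<sigma>(K := c)"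
  have ag: "agree K \<sigma> \<tau>" by (simp add: agree_def \<tau>_def)
  have other: "event_at c r = None" if "r \<noteq> p" for r
    using c(2) that by (cases c) (auto split: if_splits)
  have out: "outputs A V \<tau> K r x \<longleftrightarrow> r = p \<and> x = g p" for r x
  proof -
    have "local_state A V \<tau> K r = local_state A V \<sigma> K r"
      by (rule local_state_agree[OF ag, symmetric])
    moreover have "\<tau> K = c" by (simp add: \<tau>_def)
    ultimately show ?thesis using c other by (cases "r = p") (auto simp: outputs_def)
  qed
  have "\<not> outputs A V \<tau> k r x" if "k < Suc K" "x \<in> R" for k r x
  proof (cases "k = K")
    case True
    then show ?thesis using that(2) out assms(3) by auto
  next
    case False
    then have k: "k < K" using that(1) by simp
    then have "\<not> outputs A V \<sigma> k r x" using that(2) st unfolding stage_def by blast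
    then show ?thesis by (simp add: outputs_agree[OF ag k])
  qed
  moreover have "quiet \<tau> K (Suc K) r" if "r \<in> H" for r
  proof -
    have "r \<noteq> p" using that assms(2) by blast
    then show ?thesis by (auto simp: quiet_def \<tau>_def less_Suc_eq dest: other)
  qed
  then have "poised A V \<tau> (Suc K) r (g r)" if "r \<in> H" for r
    using that st ag by (auto simp: stage_def intro: poised_quiet)
  moreover have "safe A V \<tau> (Suc K)"
    using safe_fun_upd[OF _ c(1)] st by (simp add: \<tau>_def stage_def)
  ultimately have "stage A V R \<tau> (Suc K) H g" using st by (auto simp: stage_def)
  then show ?thesis using that ag out by blast
qed

text \<open>The processes poised for \<open>x\<close> go one by one. As \<open>x\<close> has left
  \<open>R\<close>, the first of these outputs does not spoil the invariant for the others, and each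
  stays in the prefix on which later schedules agree.\<close>

lemma stage_release:
  assumes "finite P" "P \<inter> H = {}" "stage A V R \<sigma> K (P \<union> H) g" "g ` P \<subseteq> {x}" "x \<notin> R"
  shows "\<exists>\<tau> L. agree K \<sigma> \<tau> \<and> K \<le> L \<and> stage A V R \<tau> L H g \<and> (\<forall>p\<in>P. \<exists>k<L. outputs A V \<tau> k p x)"
  using assms
proof (induction P arbitrary: \<sigma> K rule: finite_induct)
  case empty
  then have "agree K \<sigma> \<sigma> \<and> K \<le> K \<and> stage A V R \<sigma> K H g" by simp
  then show ?case by blast
next
  case (insert p P)
  obtain \<tau> where t: "agree K \<sigma> \<tau>" "stage A V R \<tau> (Suc K) (P \<union> H) g" "outputs A V \<tau> K p x"
    using stage_release_one[of A V R \<sigma> K p "P \<union> H" g] insert.prems insert.hyps by auto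
  obtain \<tau>' L where t': "agree (Suc K) \<tau> \<tau>'" "Suc K \<le> L" "stage A V R \<tau>' L H g"
    "\<forall>p\<in>P. \<exists>k<L. outputs A V \<tau>' k p x"
    using insert.IH[OF _ t(2)] insert.prems by auto
  have "outputs A V \<tau>' K p x" using t(3) by (simp only: outputs_agree[OF t'(1) lessI])
  then have "\<forall>p\<in>insert p P. \<exists>k<L. outputs A V \<tau>' k p x"
    using t'(2,4) Suc_le_lessD by blast
  moreover have "agree K \<sigma> \<tau>'" using agree_trans[OF t(1) t'(1)] by simp
  ultimately show ?case using t' Suc_leD by blast
qed

section \<open>Counting\<close>

text \<open>Otherwise the fibres would add up to less than \<open>card H\<close>. The bound is kept
  free of division; the ceiling is recovered where it is applied.\<close>

lemma pigeonhole_fibre: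
  assumes "finite H" "finite R" "R \<noteq> {}" "g ` H \<subseteq> R"
  shows "\<exists>x\<in>R. card H \<le> card {p \<in> H. g p = x} * card R"
proof (rule ccontr)
  assume "\<not> ?thesis"
  then have less: "card {p \<in> H. g p = x} * card R < card H" if "x \<in> R" for x
    using assms that not_le by blast
  have "card H * card R = (\<Sum>x\<in>R. card {p \<in> H. g p = x} * card R)"
    using sum.group[OF assms(1,2,4), of "\<lambda>_. 1::nat"] by (simp flip: sum_distrib_right)
  also have "\<dots> < (\<Sum>x\<in>R. card H)"
    using assms(2,3) less by (intro sum_strict_mono) auto
  finally show False by simp
qed

definition emitters ::
  "('s, 'm, 'v) algorithm \<Rightarrow> 'v option list \<Rightarrow> 'm schedule \<Rightarrow> 'v \<Rightarrow> nat set" where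
  "emitters A V \<tau> x = {p. p < length V \<and> (\<exists>k. outputs A V \<tau> k p x)}"

text \<open>Induction on the number of missing values. Each round fills up the held-back set,
  releases a large fibre and hands the remaining processes to the next round with one value fewer.
  The final execution extends the prefixes of all rounds, so one execution shows all the
  emitters.\<close>

lemma many_emitters:
  fixes F :: "nat \<Rightarrow> nat"
  assumes V: "V \<in> inputs A" and "finite R"
    and "\<And>\<tau> y. execution A F V \<tau> \<Longrightarrow> y \<in> R \<Longrightarrow> \<exists>k p. outputs A V \<tau> k p y"
    and "stage A V R \<sigma> K H g" "g ` H \<subseteq> R" "card H \<le> F (length V) + 1"
  shows "\<exists>\<tau>. execution A F V \<tau> \<and> agree K \<sigma> \<tau> \<and>
    (\<Sum>i = 1..card R. \<lceil>real (F (length V) + 1) / real i\<rceil>) \<le> (\<Sum>x\<in>R. int (card (emitters A V \<tau> x)))"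
  using assms(2-)
proof (induction "card R" arbitrary: R \<sigma> K H g)
  case 0
  have "safe A V \<sigma> K" using 0 by (simp add: stage_def)
  \<comment> \<open>No value is missing any more, so the prefix is completed with nobody held
    back.\<close>
  then obtain \<tau> where "execution A F V \<tau>" "agree K \<sigma> \<tau>"
    using fair_extension[OF V, of \<sigma> K "{}" F] by auto
  then show ?case using 0 by auto
next
  case (Suc m)
  let ?f = "F (length V)"
  have "R \<noteq> {}" using Suc.hyps(2) by auto
  then obtain y where y: "y \<in> R" by blast
  obtain \<tau> L H' g' where t: "agree K \<sigma> \<tau>" "K \<le> L" "stage A V R \<tau> L H' g'"
    "card H' = ?f + 1" "g' ` H' \<subseteq> R"
    using stage_fill[where F = F, OF Suc.prems(3) V y Suc.prems(2)[OF _ y] Suc.prems(5,4)] by blast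
  have sub: "H' \<subseteq> {..<length V}" using t(3) by (simp add: stage_def)
  then have fin: "finite H'" using finite_subset by blast
  \<comment> \<open>As \<open>card R = Suc m\<close>, this fibre will pay for the summand with
    \<open>i = Suc m\<close>.\<close>
  obtain x where x: "x \<in> R" "card H' \<le> card {p \<in> H'. g' p = x} * card R"
    using pigeonhole_fibre[OF fin Suc.prems(1) \<open>R \<noteq> {}\<close> t(5)] by blast
  define P where "P = {p \<in> H'. g' p = x}"
  have "P \<union> (H' - P) = H'" by (auto simp: P_def)
  \<comment> \<open>Dropping \<open>x\<close> only weakens the ban on outputs, and it must precede
    the release, whose steps output \<open>x\<close>.\<close>
  then have "stage A V (R - {x}) \<tau> L (P \<union> (H' - P)) g'"
    using t(3) by (simp add: stage_def)
  then obtain \<tau>' L' where t': "agree L \<tau> \<tau>'" "L \<le> L'" "stage A V (R - {x}) \<tau>' L' (H' - P) g'"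
    "\<forall>p\<in>P. \<exists>k<L'. outputs A V \<tau>' k p x"
    using stage_release[of P "H' - P" A V "R - {x}" \<tau> L g' x] fin by (auto simp: P_def)
  have cardR: "card (R - {x}) = m" "finite (R - {x})"
    using x(1) Suc.hyps(2) Suc.prems(1) by auto
  have "g' ` (H' - P) \<subseteq> R - {x}" using t(5) by (auto simp: P_def)
  moreover have "card (H' - P) \<le> ?f + 1" using card_mono[OF fin, of "H' - P"] t(4) by auto
  ultimately obtain \<rho> where r: "execution A F V \<rho>" "agree L' \<tau>' \<rho>"
    "(\<Sum>i = 1..m. \<lceil>real (?f + 1) / real i\<rceil>) \<le> (\<Sum>x\<in>R - {x}. int (card (emitters A V \<rho> x)))"
    using Suc.hyps(1)[of "R - {x}"] cardR Suc.prems(2) t'(3) by (metis DiffD1)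
  have "\<forall>p\<in>P. \<exists>k. outputs A V \<rho> k p x" using t'(4) outputs_agree[OF r(2)] by metis
  then have "P \<subseteq> emitters A V \<rho> x" using sub by (auto simp: emitters_def P_def)
  then have "card P \<le> card (emitters A V \<rho> x)" by (intro card_mono) (auto simp: emitters_def)
  moreover have "\<lceil>real (?f + 1) / real (Suc m)\<rceil> \<le> int (card P)"
  proof -
    have "real (?f + 1) \<le> real (card P * Suc m)"
      using x(2) t(4) Suc.hyps(2) unfolding P_def by (metis of_nat_le_iff)
    then show ?thesis by (simp add: ceiling_le_iff divide_le_eq distrib_left)
  qed
  ultimately have "\<lceil>real (?f + 1) / real (Suc m)\<rceil> \<le> int (card (emitters A V \<rho> x))" by linarith
  then have "(\<Sum>i = 1..Suc m. \<lceil>real (?f + 1) / real i\<rceil>) \<le> (\<Sum>x\<in>R. int (card (emitters A V \<rho> x)))"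
    using r(3) sum.remove[OF Suc.prems(1) x(1), of "\<lambda>x. int (card (emitters A V \<rho> x))"] by simp
  moreover have "agree K \<sigma> \<rho>"
    using t t' r(2) by (meson agree_trans order_trans)
  ultimately show ?case using r(1) Suc.hyps(2) by metis
qed

section \<open>From the task to its single executions\<close>

text \<open>Solving is a property of the task; it reaches a single execution through the output
  vector of that execution. As \<open>S\<close> is the only admissible output set, this vector
  contains all of \<open>S\<close>.\<close>

lemma solves_outputs:
  assumes "solves A F (SOS_problem {S})" "execution A F V \<sigma>" "y \<in> S"
  shows "\<exists>k p. outputs A V \<sigma> k p y"
proof -
  have T: "task_of A F \<in> SOS_problem {S}" and so: "single_output A F"
    using assms(1) by (auto simp: solves_def implements_def)
  \<comment> \<open>\<open>THE\<close> is well defined here, since \<open>single_output\<close>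
    excludes a second value.\<close>
  define W where "W = map (\<lambda>p. if \<exists>k x. outputs A V \<sigma> k p x
      then Some (THE x. \<exists>k. outputs A V \<sigma> k p x) else None) [0..<length V]"
  have the: "(THE x. \<exists>k. outputs A V \<sigma> k p x) = x" if "outputs A V \<sigma> k p x" for p k x
    using that so assms(2) unfolding single_output_def by (intro the_equality) blast+
  have W: "produces A V \<sigma> W"
    unfolding produces_def W_def using the by (auto; blast)
  obtain I D E where TD: "restrict_task (task_of A F) (length V) = (I, D, E)"
    by (metis prod_cases3)
  have E: "(V, W) \<in> E"
    using TD W assms(2) by (auto simp: restrict_task_def task_of_def produces_def)
  have "case restrict_task (task_of A F) (length V) of (I, D, E) \<Rightarrow>
      E \<noteq> {} \<longrightarrow> SOS (I, D, E) = {S} \<and> E = I \<times> D"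
    using T by (simp add: SOS_problem_def)
  \<comment> \<open>The pair \<open>(V, W)\<close> itself meets the nonemptiness condition of the
    restricted task.\<close>
  then have "SOS (I, D, E) = {S}"
    using E TD by auto
  then have "output_set W = S" using E by (fastforce simp: SOS_def)
  then obtain p where "p < length W" "W ! p = Some y"
    using assms(3) by (auto simp: output_set_def in_set_conv_nth)
  then show ?thesis using W by (auto simp: produces_def)
qed

theorem theorem5:
  fixes A :: "('s, 'm, 'v::finite) algorithm"
    and F :: "nat \<Rightarrow> nat"
    and n f d :: nat
    and v :: "nat \<Rightarrow> 'v"
  assumes "d \<ge> 1"
    and "inj_on v {1..d}"
    and "supports A F n"
    and "F n = f"
    and "f \<le> n"
    and "solves A F (SOS_problem {v ` {1..d}})"
  shows "int n \<ge> (\<Sum>i = 1..d. \<lceil>real (f + 1) / real i\<rceil>)"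
proof -
  let ?R = "v ` {1..d}"
  obtain V where V: "V \<in> inputs A" "length V = n"
    using assms(3) by (auto simp: supports_def execution_def)
  \<comment> \<open>The adversary starts from the empty prefix with nobody held back, so any
    \<open>g\<close> will do.\<close>
  have st: "stage A V ?R (\<lambda>_. Idle) 0 {} undefined"
    by (simp add: stage_def safe_def)
  obtain \<tau> where t: "execution A F V \<tau>"
    "(\<Sum>i = 1..card ?R. \<lceil>real (F n + 1) / real i\<rceil>) \<le> (\<Sum>x\<in>?R. int (card (emitters A V \<tau> x)))"
    using many_emitters[where F = F, OF V(1) _ solves_outputs[OF assms(6)] st] V(2) by auto
  have "single_output A F" using assms(6) by (auto simp: solves_def implements_def)
  \<comment> \<open>Disjointness lets the emitters of all \<open>d\<close> values be counted
    together among the \<open>n\<close> processes.\<close>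
  then have "emitters A V \<tau> x \<inter> emitters A V \<tau> y = {}" if "x \<noteq> y" for x y
    using t(1) that unfolding single_output_def emitters_def by blast
  then have "(\<Sum>x\<in>?R. card (emitters A V \<tau> x)) = card (\<Union>x\<in>?R. emitters A V \<tau> x)"
    by (intro card_UN_disjoint[symmetric]) (auto simp: emitters_def)
  also have "\<dots> \<le> card {..<n}"
    using V(2) by (intro card_mono) (auto simp: emitters_def)
  finally have "(\<Sum>x\<in>?R. int (card (emitters A V \<tau> x))) \<le> int n"
    by (simp flip: of_nat_sum)
  then show ?thesis using t(2) assms(2,4) by (simp add: card_image)
qed

end
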